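(* Let $f:\widetilde{G}\to G$ be a homotopy covering map, let $K$ be a graph, and let $\varphi,\psi:K\to G$ be graph morphisms that are homotopic via a morphism $H:K\times I_n\to G$ with $H(k,0)=\varphi(k)$ and $H(k,n)=\psi(k)$ for all vertices $k$ of $K$. Suppose $\widetilde{\varphi}:K\to\widetilde{G}$ is a graph morphism with $f\circ\widetilde{\varphi}=\varphi$. Then there is a graph morphism $\widetilde{H}:K\times I_n\to\widetilde{G}$ with $\widetilde{H}(k,0)=\widetilde{\varphi}(k)$ for all $k$ and $f\circ\widetilde{H}=H$. In particular $\widetilde{\psi}:=\widetilde{H}(-,n)$ is a lift of $\psi$ (i.e. $f\circ\widetilde\psi=\psi$) with $\widetilde{\varphi}\simeq\widetilde{\psi}$.
   Context: All graphs are undirected, have no multiple edges, may have loops (a vertex adjacent to itself), are connected, and are not a single isolated vertex (every vertex is adjacent to at least one vertex, possibly itself). Adjacency is written $x\sim y$ and $N(v)$ denotes the set of vertices adjacent to $v$. A graph morphism $f:G\to H$ is a map on vertices with $f(x)\sim f(y)$ whenever $x\sim y$. A walk of length $n$ is a sequence $(v_0v_1\cdots v_n)$ of vertices with $v_i\sim v_{i+1}$ for all $i$; $N_2(v)$ denotes the set of walks of length $2$ starting at $v$. A homotopy covering map is a graph morphism $f:\widetilde G\to G$ such that for every vertex $\tilde v$ of $\widetilde G$, applying $f$ vertexwise gives a bijection $N_2(\tilde v)\to N_2(f(\tilde v))$ which respects endpoints: two walks in $N_2(\tilde v)$ have the same final vertex if and only if their images in $N_2(f(\tilde v))$ have the same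 final vertex. The categorical product $K\times I_n$ has vertices the pairs $(k,i)$, with $(k,i)\sim(k',i')$ iff $k\sim k'$ in $K$ and $i\sim i'$ in $I_n$, where $I_n$ is the looped path graph with vertices $0,1,\dots,n$, edges $i\sim i+1$, and a loop $i\sim i$ at every vertex. Two morphisms $\varphi,\psi:K\to G$ are homotopic, written $\varphi\simeq\psi$, if there is a morphism $H:K\times I_n\to G$ for some $n$ with $H(-,0)=\varphi$ and $H(-,n)=\psi$. *)

theory Defs
  imports "Graph_Theory.Graph_Theory"
begin

text \<open>
  An undirected graph without multiple edges, possibly with loops and possibly infinite, is a
  symmetric \<^typ>\<open>'a pair_pre_digraph\<close>: the edge joining \<open>x\<close> and \<open>y\<close> is
  represented by both arcs \<open>(x, y)\<close> and \<open>(y, x)\<close>, a loop by \<open>(x, x)\<close>.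
  (The locale \<open>graph\<close> of the library is too narrow: it is finite and loop-free.)
  Note that \<^const>\<open>connected\<close> includes non-emptiness of the vertex set.
\<close>

locale loop_graph = pair_sym_digraph +
  assumes connected: "connected (with_proj G)"
    and not_isolated: "v \<in> pverts G \<Longrightarrow> \<exists>w. (v, w) \<in> parcs G"

text \<open>
  Maps on vertices are total HOL functions of which only the values on the vertex set matter;
  accordingly, equations between maps are stated on the vertices of the source only.
\<close>

definition graph_morphism ::
  "'a pair_pre_digraph \<Rightarrow> 'b pair_pre_digraph \<Rightarrow> ('a \<Rightarrow> 'b) \<Rightarrow> bool" where
  "graph_morphism G H f \<longleftrightarrow>
     (\<forall>x\<in>pverts G. f x \<in> pverts H) \<and>
     (\<forall>x y. (x, y) \<in> parcs G \<longrightarrow> (f x, f y) \<in> parcs H)"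

definition walks2 :: "'a pair_pre_digraph \<Rightarrow> 'a \<Rightarrow> 'a vwalk set" where
  "walks2 G v = {p. vwalk p (with_proj G) \<and> vwalk_length p = 2 \<and> hd p = v}"

definition homotopy_covering ::
  "'a pair_pre_digraph \<Rightarrow> 'b pair_pre_digraph \<Rightarrow> ('a \<Rightarrow> 'b) \<Rightarrow> bool" where
  "homotopy_covering G' G f \<longleftrightarrow>
     graph_morphism G' G f \<and>
     (\<forall>v\<in>pverts G'.
        bij_betw (map f) (walks2 G' v) (walks2 G (f v)) \<and>
        (\<forall>p\<in>walks2 G' v. \<forall>q\<in>walks2 G' v.
           last p = last q \<longleftrightarrow> last (map f p) = last (map f q)))"

definition looped_path :: "nat \<Rightarrow> nat pair_pre_digraph" where
  "looped_path n =
     \<lparr> pverts = {0..n},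
       parcs = {(i, j). i \<le> n \<and> j \<le> n \<and> (i = j \<or> j = i + 1 \<or> i = j + 1)} \<rparr>"

definition graph_prod ::
  "'a pair_pre_digraph \<Rightarrow> 'b pair_pre_digraph \<Rightarrow> ('a \<times> 'b) pair_pre_digraph" where
  "graph_prod K L =
     \<lparr> pverts = pverts K \<times> pverts L,
       parcs = {((k, i), (k', i')). (k, k') \<in> parcs K \<and> (i, i') \<in> parcs L} \<rparr>"

definition is_homotopy ::
  "'a pair_pre_digraph \<Rightarrow> 'b pair_pre_digraph \<Rightarrow> nat \<Rightarrow> ('a \<times> nat \<Rightarrow> 'b) \<Rightarrow>
    ('a \<Rightarrow> 'b) \<Rightarrow> ('a \<Rightarrow> 'b) \<Rightarrow> bool" where
  "is_homotopy K G n H \<phi> \<psi> \<longleftrightarrow>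
     graph_morphism (graph_prod K (looped_path n)) G H \<and>
     (\<forall>k\<in>pverts K. H (k, 0) = \<phi> k) \<and>
     (\<forall>k\<in>pverts K. H (k, n) = \<psi> k)"

definition homotopic ::
  "'a pair_pre_digraph \<Rightarrow> 'b pair_pre_digraph \<Rightarrow> ('a \<Rightarrow> 'b) \<Rightarrow> ('a \<Rightarrow> 'b) \<Rightarrow> bool" where
  "homotopic K G \<phi> \<psi> \<longleftrightarrow>
     graph_morphism K G \<phi> \<and> graph_morphism K G \<psi> \<and> (\<exists>n H. is_homotopy K G n H \<phi> \<psi>)"

end

theory Submission
  imports Defs
begin

text \<open>
  A homotopy covering map lifts edges, is injective on neighbourhoods, and 2-walks from a common
  vertex whose images end at the same vertex themselves end at the same vertex.  Hence a homotopy
  lifts one time step at a time: if \<open>\<phi>'\<close> lifts time \<open>i\<close> and \<open>k \<sim> k'\<close>, then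
  the point of time \<open>i + 1\<close> over \<open>k\<close> is obtained by lifting an edge at \<open>\<phi>' k'\<close>, and it
  does not depend on the choice of \<open>k'\<close>, since changing \<open>k'\<close> only changes the middle vertex
  of a 2-walk from \<open>\<phi>' k\<close>.
\<close>

lemma walks2_iff:
  assumes "pair_sym_digraph G"
  shows "p \<in> walks2 G v \<longleftrightarrow> (\<exists>w x. p = [v, w, x] \<and> (v, w) \<in> parcs G \<and> (w, x) \<in> parcs G)"
proof -
  interpret pair_sym_digraph G by fact
  have "vwalk_length p = 2 \<and> hd p = v \<longleftrightarrow> (\<exists>w x. p = [v, w, x])"
  proof
    assume "vwalk_length p = 2 \<and> hd p = v"
    then have "length p = Suc (Suc (Suc 0))" "hd p = v" by auto
    then show "\<exists>w x. p = [v, w, x]" by (auto simp: length_Suc_conv)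
  qed auto
  then have "p \<in> walks2 G v \<longleftrightarrow> (\<exists>w x. p = [v, w, x] \<and> vwalk [v, w, x] (with_proj G))"
    unfolding walks2_def by auto
  \<comment> \<open>\<open>vwalk\<close> also demands that every vertex of the list lies in the
    graph; this follows since both ends of an arc are vertices.\<close>
  moreover have "vwalk [v, w, x] (with_proj G) \<longleftrightarrow> (v, w) \<in> parcs G \<and> (w, x) \<in> parcs G" for w x
    using in_arcsD1[of v w] in_arcsD1[of w x] in_arcsD2[of w x] by (auto simp: vwalk_def)
  ultimately show ?thesis by simp
qed

text \<open>By symmetry each edge at \<open>v\<close> gives a back-and-forth 2-walk
  \<open>[v, w, v]\<close>. Neighbours with equal images give such walks with equal images, and
  \<open>f\<close> is injective on 2-walks from \<open>v\<close>.\<close>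

lemma homotopy_covering_inj_neighbours:
  assumes "pair_sym_digraph G'" "homotopy_covering G' G f"
    and vw: "(v, w) \<in> parcs G'" and vw': "(v, w') \<in> parcs G'" and eq: "f w = f w'"
  shows "w = w'"
proof -
  interpret G': pair_sym_digraph G' by fact
  have "(w, v) \<in> parcs G'" "(w', v) \<in> parcs G'" and v: "v \<in> pverts G'"
    using G'.arcs_symmetric[OF vw] G'.arcs_symmetric[OF vw'] G'.in_arcsD1[OF vw] by simp_all
  with vw vw' have "[v, w, v] \<in> walks2 G' v" "[v, w', v] \<in> walks2 G' v"
    by (simp_all add: walks2_iff[OF assms(1)])
  moreover have "inj_on (map f) (walks2 G' v)"
    using assms(2) v by (simp add: homotopy_covering_def bij_betw_def)
  moreover have "map f [v, w, v] = map f [v, w', v]"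
    using eq by simp
  ultimately have "[v, w, v] = [v, w', v]"
    by (blast dest: inj_onD)
  then show ?thesis by simp
qed

text \<open>The covering condition lifts 2-walks rather than arcs, so the arc at \<open>f w\<close>
  is prolonged backwards to \<open>f v\<close>. The lifted walk starts at \<open>v\<close>, and
  injectivity on the neighbours of \<open>v\<close> forces its middle vertex to be
  \<open>w\<close>.\<close>

lemma homotopy_covering_lift_arc:
  assumes "pair_sym_digraph G'" "pair_sym_digraph G" "homotopy_covering G' G f"
    and vw: "(v, w) \<in> parcs G'" and arc: "(f w, z) \<in> parcs G"
  obtains x where "(w, x) \<in> parcs G'" "f x = z"
proof -
  interpret G': pair_sym_digraph G' by fact
  have v: "v \<in> pverts G'" using vw by (rule G'.in_arcsD1)
  have "(f v, f w) \<in> parcs G"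
    using assms(3) vw by (simp add: homotopy_covering_def graph_morphism_def)
  then have "[f v, f w, z] \<in> walks2 G (f v)"
    using arc by (simp add: walks2_iff[OF assms(2)])
  moreover have "map f ` walks2 G' v = walks2 G (f v)"
    using assms(3) v by (simp add: homotopy_covering_def bij_betw_def)
  ultimately obtain p where "p \<in> walks2 G' v" "[f v, f w, z] = map f p"
    by blast
  then obtain u x where u: "(v, u) \<in> parcs G'" "f w = f u" "(u, x) \<in> parcs G'" "f x = z"
    by (auto simp: walks2_iff[OF assms(1)])
  have "w = u"
    using homotopy_covering_inj_neighbours[OF assms(1,3) vw u(1,2)] .
  with u show ?thesis using that by blast
qed

lemma homotopy_covering_walk_end_unique:
  assumes "pair_sym_digraph G'" "homotopy_covering G' G f"
    and "(v, w) \<in> parcs G'" "(w, x) \<in> parcs G'" "(v, w') \<in> parcs G'" "(w', x') \<in> parcs G'"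
    and "f x = f x'"
  shows "x = x'"
proof -
  interpret G': pair_sym_digraph G' by fact
  have "[v, w, x] \<in> walks2 G' v" "[v, w', x'] \<in> walks2 G' v" "v \<in> pverts G'"
    using assms(3-6) G'.in_arcsD1[OF assms(3)] by (simp_all add: walks2_iff[OF assms(1)])
  then have "last [v, w, x] = last [v, w', x'] \<longleftrightarrow>
      last (map f [v, w, x]) = last (map f [v, w', x'])"
    using assms(2) unfolding homotopy_covering_def by blast
  with assms(7) show ?thesis by simp
qed

text \<open>Here \<open>\<phi>\<close> and \<open>\<chi>\<close> stand for two consecutive times of
  a homotopy. Uniqueness of endpoints is used twice: to make \<open>\<chi>'\<close> well defined,
  and to show that \<open>\<chi>'\<close> preserves arcs.\<close>

lemma homotopy_covering_lift_step:
  assumes "pair_sym_digraph G'" "pair_sym_digraph G" "loop_graph K"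
    and cov: "homotopy_covering G' G f"
    and \<phi>': "graph_morphism K G' \<phi>'" and lift: "\<forall>k\<in>pverts K. f (\<phi>' k) = \<phi> k"
    and \<chi>: "graph_morphism K G \<chi>"
    and \<phi>\<chi>: "\<And>k k'. (k, k') \<in> parcs K \<Longrightarrow> (\<phi> k, \<chi> k') \<in> parcs G"
  obtains \<chi>' where "graph_morphism K G' \<chi>'" "\<forall>k\<in>pverts K. f (\<chi>' k) = \<chi> k"
    "\<forall>k k'. (k, k') \<in> parcs K \<longrightarrow> (\<phi>' k, \<chi>' k') \<in> parcs G'"
proof -
  interpret G': pair_sym_digraph G' by fact
  interpret K: loop_graph K by fact
  have \<phi>'_arc: "(\<phi>' k, \<phi>' k') \<in> parcs G'" if "(k, k') \<in> parcs K" for k k'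
    using \<phi>' that by (simp add: graph_morphism_def)
  have arc_lift: "\<exists>x. (\<phi>' k', x) \<in> parcs G' \<and> f x = \<chi> k" if kk': "(k, k') \<in> parcs K" for k k'
  proof -
    have k'k: "(k', k) \<in> parcs K" and "k' \<in> pverts K"
      using kk' by (auto intro: K.arcs_symmetric dest: K.in_arcsD2)
    then have "(f (\<phi>' k'), \<chi> k) \<in> parcs G" using lift \<phi>\<chi> by simp
    then obtain x where "(\<phi>' k', x) \<in> parcs G'" "f x = \<chi> k"
      by (rule homotopy_covering_lift_arc[OF assms(1,2) cov \<phi>'_arc[OF kk']])
    then show ?thesis by blast
  qed
  have "\<exists>x. f x = \<chi> k \<and> (\<forall>k'. (k, k') \<in> parcs K \<longrightarrow> (\<phi>' k', x) \<in> parcs G')"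
    if k: "k \<in> pverts K" for k
  proof -
    obtain k0 where k0: "(k, k0) \<in> parcs K" using K.not_isolated[OF k] by blast
    obtain x where x: "(\<phi>' k0, x) \<in> parcs G'" "f x = \<chi> k" using arc_lift[OF k0] by blast
    have "(\<phi>' k', x) \<in> parcs G'" if kk': "(k, k') \<in> parcs K" for k'
    proof -
      obtain y where y: "(\<phi>' k', y) \<in> parcs G'" "f y = \<chi> k" using arc_lift[OF kk'] by blast
      \<comment> \<open>Both 2-walks start at \<open>\<phi>' k\<close>, one through
        \<open>\<phi>' k'\<close> and one through \<open>\<phi>' k0\<close>, and both end over
        \<open>\<chi> k\<close>.\<close>
      have "y = x"
        using homotopy_covering_walk_end_unique[OF assms(1) cov \<phi>'_arc[OF kk'] y(1)
            \<phi>'_arc[OF k0] x(1)] x(2) y(2) by simp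
      with y show ?thesis by simp
    qed
    with x show ?thesis by blast
  qed
  then obtain \<chi>' where \<chi>': "\<And>k. k \<in> pverts K \<Longrightarrow> f (\<chi>' k) = \<chi> k"
    "\<And>k k'. k \<in> pverts K \<Longrightarrow> (k, k') \<in> parcs K \<Longrightarrow> (\<phi>' k', \<chi>' k) \<in> parcs G'"
    by metis
  have cross: "(\<phi>' k, \<chi>' k') \<in> parcs G'" if "(k, k') \<in> parcs K" for k k'
    using \<chi>'(2)[OF K.in_arcsD2[OF that] K.arcs_symmetric[OF that]] .
  have arc: "(\<chi>' k, \<chi>' k') \<in> parcs G'" if kk': "(k, k') \<in> parcs K" for k k'
  proof -
    have k'k: "(k', k) \<in> parcs K" using kk' by (rule K.arcs_symmetric)
    have k: "k \<in> pverts K" and k': "k' \<in> pverts K"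
      using kk' by (auto dest: K.in_arcsD1 K.in_arcsD2)
    \<comment> \<open>The arc from \<open>\<chi> k'\<close> to \<open>\<chi> k\<close> is lifted at
      \<open>\<chi>' k'\<close>. Its end \<open>x\<close> must be \<open>\<chi>' k\<close>, by
      comparing the walks \<open>[\<phi>' k, \<chi>' k', x]\<close> and
      \<open>[\<phi>' k, \<phi>' k', \<chi>' k]\<close>.\<close>
    have "(f (\<chi>' k'), \<chi> k) \<in> parcs G"
      using \<chi> k'k \<chi>'(1)[OF k'] by (simp add: graph_morphism_def)
    then obtain x where x: "(\<chi>' k', x) \<in> parcs G'" "f x = \<chi> k"
      by (rule homotopy_covering_lift_arc[OF assms(1,2) cov cross[OF kk']])
    have "x = \<chi>' k"
      using homotopy_covering_walk_end_unique[OF assms(1) cov cross[OF kk'] x(1)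
          \<phi>'_arc[OF kk'] cross[OF k'k]] x(2) \<chi>'(1)[OF k] by simp
    with x(1) show ?thesis using G'.arcs_symmetric by blast
  qed
  have "\<chi>' k \<in> pverts G'" if "k \<in> pverts K" for k
    using K.not_isolated[OF that] arc by (blast dest: G'.in_arcsD1)
  with arc have "graph_morphism K G' \<chi>'" by (simp add: graph_morphism_def)
  with \<chi>'(1) cross show ?thesis using that by blast
qed

lemma pverts_graph_prod_looped_path:
  "pverts (graph_prod K (looped_path n)) = pverts K \<times> {..n}"
  by (auto simp: graph_prod_def looped_path_def)

text \<open>The loop at \<open>i\<close> accounts for the arcs within level \<open>i\<close>, so
  that each level is a morphism; the edge between \<open>i\<close> and \<open>Suc i\<close> accounts
  for the mixed arcs, in both directions.\<close>

lemma graph_morphism_prod_looped_path_iff: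
  "graph_morphism (graph_prod K (looped_path n)) G H \<longleftrightarrow>
    (\<forall>i\<le>n. graph_morphism K G (\<lambda>k. H (k, i))) \<and>
    (\<forall>i<n. \<forall>k k'. (k, k') \<in> parcs K \<longrightarrow>
      (H (k, i), H (k', Suc i)) \<in> parcs G \<and> (H (k, Suc i), H (k', i)) \<in> parcs G)"
  unfolding graph_morphism_def graph_prod_def looped_path_def
  by (auto simp: Suc_le_eq)

lemma graph_morphism_prod_looped_path_Suc:
  "graph_morphism (graph_prod K (looped_path (Suc n))) G H \<longleftrightarrow>
    graph_morphism (graph_prod K (looped_path n)) G H \<and>
    graph_morphism K G (\<lambda>k. H (k, Suc n)) \<and>
    (\<forall>k k'. (k, k') \<in> parcs K \<longrightarrow>
      (H (k, n), H (k', Suc n)) \<in> parcs G \<and> (H (k, Suc n), H (k', n)) \<in> parcs G)"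
  unfolding graph_morphism_prod_looped_path_iff by (auto simp: le_Suc_eq less_Suc_eq)

text \<open>Induction on \<open>n\<close>: the lift over the first \<open>n\<close> levels is
  extended by one step, applied to its last level.\<close>

lemma homotopy_covering_lift_homotopy:
  assumes "pair_sym_digraph G'" "pair_sym_digraph G" "loop_graph K"
    and cov: "homotopy_covering G' G f"
    and \<phi>': "graph_morphism K G' \<phi>'" and lift: "\<forall>k\<in>pverts K. f (\<phi>' k) = H (k, 0)"
    and H: "graph_morphism (graph_prod K (looped_path n)) G H"
  shows "\<exists>H'. graph_morphism (graph_prod K (looped_path n)) G' H' \<and>
    (\<forall>k\<in>pverts K. H' (k, 0) = \<phi>' k) \<and> (\<forall>k\<in>pverts K. \<forall>i\<le>n. f (H' (k, i)) = H (k, i))"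
  using H
proof (induction n)
  case 0
  \<comment> \<open>Only level 0 exists, so the map that is constant in time serves as the
    lift.\<close>
  then show ?case
    using \<phi>' lift
    by (intro exI[of _ "\<lambda>(k, i). \<phi>' k"]) (auto simp: graph_morphism_prod_looped_path_iff)
next
  case (Suc n)
  interpret G': pair_sym_digraph G' by fact
  interpret K: loop_graph K by fact
  from Suc.prems have H: "graph_morphism (graph_prod K (looped_path n)) G H"
    "graph_morphism K G (\<lambda>k. H (k, Suc n))"
    "\<And>k k'. (k, k') \<in> parcs K \<Longrightarrow> (H (k, n), H (k', Suc n)) \<in> parcs G"
    by (auto simp: graph_morphism_prod_looped_path_Suc)
  from Suc.IH[OF H(1)] obtain H' where
    H': "graph_morphism (graph_prod K (looped_path n)) G' H'" "\<forall>k\<in>pverts K. H' (k, 0) = \<phi>' k"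
      "\<forall>k\<in>pverts K. \<forall>i\<le>n. f (H' (k, i)) = H (k, i)"
    by blast
  have "graph_morphism K G' (\<lambda>k. H' (k, n))" "\<forall>k\<in>pverts K. f (H' (k, n)) = H (k, n)"
    using H' by (auto simp: graph_morphism_prod_looped_path_iff)
  then obtain \<chi>' where \<chi>': "graph_morphism K G' \<chi>'" "\<forall>k\<in>pverts K. f (\<chi>' k) = H (k, Suc n)"
    "\<forall>k k'. (k, k') \<in> parcs K \<longrightarrow> (H' (k, n), \<chi>' k') \<in> parcs G'"
    by (rule homotopy_covering_lift_step[OF assms(1-3) cov _ _ H(2,3)])
  \<comment> \<open>The one-step lift provides mixed arcs from level \<open>n\<close> to level
    \<open>Suc n\<close> only; the reverse ones come from symmetry of \<open>K\<close> and
    \<open>G'\<close>.\<close>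
  have \<chi>'_sym: "(\<chi>' k, H' (k', n)) \<in> parcs G'" if "(k, k') \<in> parcs K" for k k'
    using G'.arcs_symmetric \<chi>'(3) K.arcs_symmetric[OF that] by blast
  define H'' where "H'' = (\<lambda>(k, i). if i = Suc n then \<chi>' k else H' (k, i))"
  have H''_le: "H'' (k, i) = H' (k, i)" if "i \<le> n" for k i
    using that by (simp add: H''_def)
  have H''_Suc: "H'' (k, Suc n) = \<chi>' k" for k
    by (simp add: H''_def)
  have "graph_morphism (graph_prod K (looped_path n)) G' H''"
    using H'(1) by (auto simp: graph_morphism_prod_looped_path_iff H''_le)
  with \<chi>' \<chi>'_sym have "graph_morphism (graph_prod K (looped_path (Suc n))) G' H''"
    by (simp add: graph_morphism_prod_looped_path_Suc H''_le H''_Suc)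
  with H' \<chi>'(2) show ?case
    by (intro exI[of _ H'']) (auto simp: H''_le H''_Suc le_Suc_eq)
qed

theorem theorem3p9:
  fixes G' :: "'a pair_pre_digraph" and G :: "'b pair_pre_digraph"
    and K :: "'k pair_pre_digraph" and n :: nat
    and f :: "'a \<Rightarrow> 'b" and \<phi> \<psi> :: "'k \<Rightarrow> 'b" and \<phi>' :: "'k \<Rightarrow> 'a"
    and H :: "'k \<times> nat \<Rightarrow> 'b"
  assumes "loop_graph G'" and "loop_graph G" and "loop_graph K"
    and "homotopy_covering G' G f"
    and "graph_morphism K G \<phi>" and "graph_morphism K G \<psi>"
    and "is_homotopy K G n H \<phi> \<psi>"
    and "graph_morphism K G' \<phi>'" and "\<forall>k\<in>pverts K. f (\<phi>' k) = \<phi> k"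
  shows "\<exists>H'. graph_morphism (graph_prod K (looped_path n)) G' H'
    \<and> (\<forall>k\<in>pverts K. H' (k, 0) = \<phi>' k)
    \<and> (\<forall>x\<in>pverts (graph_prod K (looped_path n)). f (H' x) = H x)
    \<and> graph_morphism K G' (\<lambda>k. H' (k, n))
    \<and> (\<forall>k\<in>pverts K. f (H' (k, n)) = \<psi> k)
    \<and> homotopic K G' \<phi>' (\<lambda>k. H' (k, n))"
proof -
  have sym: "pair_sym_digraph G'" "pair_sym_digraph G"
    using assms(1,2) by (auto dest: loop_graph.axioms)
  have H: "graph_morphism (graph_prod K (looped_path n)) G H"
    "\<forall>k\<in>pverts K. H (k, 0) = \<phi> k" "\<forall>k\<in>pverts K. H (k, n) = \<psi> k"
    using assms(7) by (auto simp: is_homotopy_def)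
  then have "\<forall>k\<in>pverts K. f (\<phi>' k) = H (k, 0)" using assms(9) by simp
  from homotopy_covering_lift_homotopy[OF sym assms(3,4,8) this H(1)]
  obtain H' where H': "graph_morphism (graph_prod K (looped_path n)) G' H'"
    "\<forall>k\<in>pverts K. H' (k, 0) = \<phi>' k" "\<forall>k\<in>pverts K. \<forall>i\<le>n. f (H' (k, i)) = H (k, i)"
    by blast
  have end_morphism: "graph_morphism K G' (\<lambda>k. H' (k, n))"
    using H'(1) by (simp add: graph_morphism_prod_looped_path_iff)
  \<comment> \<open>The lifted map is itself the homotopy between the two lifts.\<close>
  have "is_homotopy K G' n H' \<phi>' (\<lambda>k. H' (k, n))"
    using H'(1,2) by (simp add: is_homotopy_def)
  then have "homotopic K G' \<phi>' (\<lambda>k. H' (k, n))"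
    using assms(8) end_morphism by (auto simp: homotopic_def)
  then show ?thesis
    using H' H(3) end_morphism
    by (intro exI[of _ H']) (auto simp: pverts_graph_prod_looped_path)
qed

end
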